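(* Let $\tau_{\mathsf{min}}^{\mathsf{i}}$ be the topology on $\mathscr{C}_{\mathbb{Z}}^{\mathbf{0}}$ in which all non-zero elements are isolated points and in which the family of all sets $$\left\{(x,y)\in\mathscr{C}_{\mathbb{Z}}\colon x\geqslant a \text{ and } y\geqslant b\right\}\cup\{\mathbf{0}\},\qquad a,b\in\mathbb{Z},$$ is a base at zero $\mathbf{0}$. Then $\left(\mathscr{C}_{\mathbb{Z}}^{\mathbf{0}},\tau_{\mathsf{min}}^{\mathsf{i}}\right)$ is a minimal topological inverse semigroup.
   Context: The extended bicyclic semigroup is the set $\mathscr{C}_{\mathbb{Z}}=\mathbb{Z}\times\mathbb{Z}$ with the operation $(a,b)\cdot(c,d)=(a-b+c,d)$ if $b<c$; $(a,b)\cdot(c,d)=(a,d)$ if $b=c$; $(a,b)\cdot(c,d)=(a,d+b-c)$ if $b>c$. $\mathscr{C}_{\mathbb{Z}}^{\mathbf{0}}=\mathscr{C}_{\mathbb{Z}}\sqcup\{\mathbf{0}\}$ is $\mathscr{C}_{\mathbb{Z}}$ with an adjoined zero $\mathbf{0}$. It is an inverse semigroup with inversion $(a,b)^{-1}=(b,a)$, $\mathbf{0}^{-1}=\mathbf{0}$. A topological inverse semigroup is an inverse semigroup with a topology for which the multiplication is (jointly) continuous and the inversion is continuous; such a topology is called an inverse semigroup topology. A Hausdorff topological inverse semigroup $(S,\tau)$ is minimal if no Hausdorff inverse semigroup topology on $S$ is strictly contained in $\tau$. *)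

theory Defs
  imports "HOL-Analysis.Analysis"
begin

locale inverse_semigroup = semigroup +
  assumes ex1_inverse: "\<exists>!y. x \<^bold>* y \<^bold>* x = x \<and> y \<^bold>* x \<^bold>* y = y"
begin

definition inversion :: "'a \<Rightarrow> 'a" where
  "inversion x = (THE y. x \<^bold>* y \<^bold>* x = x \<and> y \<^bold>* x \<^bold>* y = y)"

end

text \<open>No separation axiom is part of this notion; \<open>Hausdorff_space\<close> is always required explicitly.\<close>

locale topological_inverse_semigroup = inverse_semigroup f
  for f :: "'a \<Rightarrow> 'a \<Rightarrow> 'a" +
  fixes T :: "'a topology"
  assumes topspace_UNIV: "topspace T = UNIV"
    and continuous_mult: "continuous_map (prod_topology T T) T (\<lambda>(x, y). f x y)"
    and continuous_inversion: "continuous_map T T inversion"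

definition minimal_topological_inverse_semigroup ::
  "('a \<Rightarrow> 'a \<Rightarrow> 'a) \<Rightarrow> 'a topology \<Rightarrow> bool" where
  "minimal_topological_inverse_semigroup f T \<longleftrightarrow>
     topological_inverse_semigroup f T \<and> Hausdorff_space T \<and>
     \<not> (\<exists>T'. topological_inverse_semigroup f T' \<and> Hausdorff_space T' \<and>
           {U. openin T' U} \<subset> {U. openin T U})"

fun ext_bicyclic_mult :: "int \<times> int \<Rightarrow> int \<times> int \<Rightarrow> int \<times> int" where
  "ext_bicyclic_mult (a, b) (c, d) =
     (if b < c then (a - b + c, d)
      else if b = c then (a, d)
      else (a, d + b - c))"

text \<open>In \<open>(int \<times> int) option\<close>, \<open>None\<close> is the adjoined zero.\<close>

type_synonym ext_bicyclic0 = "(int \<times> int) option"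

fun ext_bicyclic0_mult :: "ext_bicyclic0 \<Rightarrow> ext_bicyclic0 \<Rightarrow> ext_bicyclic0" where
  "ext_bicyclic0_mult (Some p) (Some q) = Some (ext_bicyclic_mult p q)"
| "ext_bicyclic0_mult _ _ = None"

definition zero_nbhd :: "int \<Rightarrow> int \<Rightarrow> ext_bicyclic0 set" where
  "zero_nbhd a b = Some ` {(x, y). x \<ge> a \<and> y \<ge> b} \<union> {None}"

definition tau_min_i :: "ext_bicyclic0 topology" where
  "tau_min_i = topology (\<lambda>U. None \<in> U \<longrightarrow> (\<exists>a b. zero_nbhd a b \<subseteq> U))"

lemma openin_tau_min_i:
  "openin tau_min_i U \<longleftrightarrow> (None \<in> U \<longrightarrow> (\<exists>a b. zero_nbhd a b \<subseteq> U))"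
proof -
  let ?P = "\<lambda>U. None \<in> U \<longrightarrow> (\<exists>a b. zero_nbhd a b \<subseteq> U)"
  have *: "zero_nbhd (max a c) (max b d) \<subseteq> zero_nbhd a b \<inter> zero_nbhd c d" for a b c d
    by (auto simp: zero_nbhd_def)
  have "?P (U \<inter> V)" if U: "?P U" and V: "?P V" for U V
  proof
    assume "None \<in> U \<inter> V"
    then obtain a b c d where "zero_nbhd a b \<subseteq> U" "zero_nbhd c d \<subseteq> V"
      using U V by blast
    with * [of a c b d] have "zero_nbhd (max a c) (max b d) \<subseteq> U \<inter> V"
      by blast
    then show "\<exists>a b. zero_nbhd a b \<subseteq> U \<inter> V"
      by blast
  qed
  moreover have "?P (\<Union>K)" if K: "\<And>U. U \<in> K \<Longrightarrow> ?P U" for K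
  proof
    assume "None \<in> \<Union>K"
    then obtain U where U: "U \<in> K" "None \<in> U"
      by blast
    then obtain a b where "zero_nbhd a b \<subseteq> U"
      using K by blast
    with U have "zero_nbhd a b \<subseteq> \<Union>K"
      by blast
    then show "\<exists>a b. zero_nbhd a b \<subseteq> \<Union>K"
      by blast
  qed
  ultimately have "istopology ?P"
    unfolding istopology_def by (intro conjI allI impI) auto
  then show ?thesis
    by (simp add: tau_min_i_def)
qed

text \<open>The defining properties: the space is all of \<open>ext_bicyclic0\<close>, non-zero elements are
  isolated, and the sets \<open>zero_nbhd a b\<close> form a base at zero.\<close>

lemma topspace_tau_min_i: "topspace tau_min_i = UNIV"
proof -
  have "openin tau_min_i UNIV"
    by (simp add: openin_tau_min_i)
  then show ?thesis
    using openin_subset by blast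
qed

lemma isolated_tau_min_i: "openin tau_min_i {Some p}"
  by (simp add: openin_tau_min_i)

lemma base_at_zero_tau_min_i:
  "openin tau_min_i (zero_nbhd a b)" "None \<in> zero_nbhd a b"
  "openin tau_min_i U \<Longrightarrow> None \<in> U \<Longrightarrow> \<exists>a b. zero_nbhd a b \<subseteq> U"
proof -
  show "None \<in> zero_nbhd a b"
    by (simp add: zero_nbhd_def)
  show "openin tau_min_i (zero_nbhd a b)"
    unfolding openin_tau_min_i by blast
  show "openin tau_min_i U \<Longrightarrow> None \<in> U \<Longrightarrow> \<exists>a b. zero_nbhd a b \<subseteq> U"
    unfolding openin_tau_min_i by (rule mp)
qed

end

theory Submission
  imports Defs
begin

text \<open>
  Minimality holds because the topology \<open>tau_min_i\<close> is coarser than \<^emph>\<open>every\<close> Hausdorff inverse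
  semigroup topology \<open>T\<close>. For an idempotent \<open>e = (a, a)\<close> and \<open>s = (x, y)\<close> one has
  \<open>s s\<^sup>-\<^sup>1 = (x, x)\<close> and \<open>e (x, x) = (max a x, max a x)\<close>. Hence the half-plane \<open>x \<le> a\<close> is the
  equaliser of \<open>s \<mapsto> s s\<^sup>-\<^sup>1 e\<close> and the constant \<open>e\<close>, while its complement (which contains zero)
  is the equaliser of \<open>s \<mapsto> e' s\<close> and the identity, where \<open>e' = (a + 1, a + 1)\<close>. Both are
  \<open>T\<close>-closed, so these half-planes are \<open>T\<close>-clopen; by inversion so are the half-planes \<open>y \<le> b\<close>.
  All the basic open sets of \<open>tau_min_i\<close> are Boolean combinations of half-planes.
\<close>

section \<open>Inverse semigroup structure\<close>

lemma ext_bicyclic_mult_assoc: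
  "ext_bicyclic_mult (ext_bicyclic_mult p q) r = ext_bicyclic_mult p (ext_bicyclic_mult q r)"
  by (cases p; cases q; cases r) auto

text \<open>Stated as an equivalence, this gives existence and uniqueness of the inverse at once and
  identifies inversion as the coordinate swap.\<close>

lemma ext_bicyclic_mult_inverse_iff:
  "ext_bicyclic_mult (ext_bicyclic_mult p q) p = p \<and>
   ext_bicyclic_mult (ext_bicyclic_mult q p) q = q \<longleftrightarrow> q = prod.swap p"
  by (cases p; cases q) (auto split: if_splits)

lemma ext_bicyclic0_mult_None_right [simp]: "ext_bicyclic0_mult s None = None"
  by (cases s) auto

lemma ext_bicyclic0_mult_inverse_iff:
  "ext_bicyclic0_mult (ext_bicyclic0_mult s t) s = s \<and>
   ext_bicyclic0_mult (ext_bicyclic0_mult t s) t = t \<longleftrightarrow> t = map_option prod.swap s"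
  using ext_bicyclic_mult_inverse_iff by (cases s; cases t) auto

interpretation ext_bicyclic0: inverse_semigroup ext_bicyclic0_mult
proof
  show "ext_bicyclic0_mult (ext_bicyclic0_mult s t) u =
        ext_bicyclic0_mult s (ext_bicyclic0_mult t u)" for s t u
    by (cases s; cases t; cases u) (simp_all add: ext_bicyclic_mult_assoc del: ext_bicyclic_mult.simps)
  show "\<exists>!t. ext_bicyclic0_mult (ext_bicyclic0_mult s t) s = s \<and>
             ext_bicyclic0_mult (ext_bicyclic0_mult t s) t = t" for s
    by (simp add: ext_bicyclic0_mult_inverse_iff)
qed

lemma ext_bicyclic0_inversion: "ext_bicyclic0.inversion = map_option prod.swap"
  by (simp add: fun_eq_iff ext_bicyclic0.inversion_def ext_bicyclic0_mult_inverse_iff)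

section \<open>Continuity of the operations and separation for \<open>tau_min_i\<close>\<close>

lemma Some_in_zero_nbhd_iff [simp]: "Some (x, y) \<in> zero_nbhd a b \<longleftrightarrow> a \<le> x \<and> b \<le> y"
  by (auto simp: zero_nbhd_def)

lemma None_in_zero_nbhd [simp]: "None \<in> zero_nbhd a b"
  by (simp add: zero_nbhd_def)

lemma zero_nbhd_cases:
  assumes "s \<in> zero_nbhd a b"
  obtains "s = None" | x y where "s = Some (x, y)" "a \<le> x" "b \<le> y"
  using assms by (auto simp: zero_nbhd_def)

text \<open>A nonzero product has first coordinate at least that of its left factor and second
  coordinate at least that of its right factor.\<close>

lemma zero_nbhd_mult_zero_nbhd:
  assumes "s \<in> zero_nbhd a b" and "t \<in> zero_nbhd a b"
  shows "ext_bicyclic0_mult s t \<in> zero_nbhd a b"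
  using assms by (auto elim!: zero_nbhd_cases)

text \<open>For \<open>t = Some (x, y)\<close> with \<open>d \<le> x\<close> the product is
  \<open>Some (c - d + x, y)\<close>. The bound \<open>d\<close> ensures this case, and
  \<open>a - c + d\<close> makes the new first coordinate at least \<open>a\<close>.\<close>

lemma Some_mult_zero_nbhd:
  assumes "t \<in> zero_nbhd (max d (a - c + d)) b"
  shows "ext_bicyclic0_mult (Some (c, d)) t \<in> zero_nbhd a b"
  using assms by (auto elim!: zero_nbhd_cases)

text \<open>The mirror case: if \<open>c \<le> y\<close>, then \<open>(x, y)\<close> times
  \<open>(c, d)\<close> is \<open>(x, d + y - c)\<close>, whose second coordinate is at least
  \<open>b\<close> once \<open>b - d + c \<le> y\<close>.\<close>

lemma zero_nbhd_mult_Some: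
  assumes "s \<in> zero_nbhd a (max c (b - d + c))"
  shows "ext_bicyclic0_mult s (Some (c, d)) \<in> zero_nbhd a b"
  using assms by (auto elim!: zero_nbhd_cases)

lemma continuous_map_tau_min_i_mult:
  "continuous_map (prod_topology tau_min_i tau_min_i) tau_min_i (\<lambda>(s, t). ext_bicyclic0_mult s t)"
proof -
  \<comment> \<open>An open box is sought around each point of the preimage. A nonzero product has
    two isolated factors; a zero product has a zero factor, whose neighbourhood must be adapted to
    the other factor.\<close>
  have *: "\<exists>V W. openin tau_min_i V \<and> openin tau_min_i W \<and> s \<in> V \<and> t \<in> W \<and>
              V \<times> W \<subseteq> {(s, t). ext_bicyclic0_mult s t \<in> U}"
    if U: "openin tau_min_i U" and st: "ext_bicyclic0_mult s t \<in> U" for U s t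
  proof (cases "ext_bicyclic0_mult s t")
    case None
    with U st obtain a b where ab: "zero_nbhd a b \<subseteq> U"
      by (auto simp: openin_tau_min_i)
    have sets: "s = None \<or> t = None"
      using None by (cases s; cases t) auto
    show ?thesis
    proof (cases s)
      case None
      show ?thesis
      proof (cases t)
        case None
        with \<open>s = None\<close> ab show ?thesis
          by (intro exI [of _ "zero_nbhd a b"])
             (auto simp: base_at_zero_tau_min_i(1) zero_nbhd_mult_zero_nbhd subset_eq)
      next
        case (Some q)
        obtain c d where "q = (c, d)"
          by fastforce
        with None Some ab show ?thesis
          by (intro exI [of _ "zero_nbhd a (max c (b - d + c))"] exI [of _ "{t}"])
             (auto simp: base_at_zero_tau_min_i(1) isolated_tau_min_i
                intro!: subsetD [OF ab] zero_nbhd_mult_Some)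
      qed
    next
      case (Some p)
      obtain c d where "p = (c, d)"
        by fastforce
      with sets Some ab show ?thesis
        by (intro exI [of _ "{s}"] exI [of _ "zero_nbhd (max d (a - c + d)) b"])
           (auto simp: base_at_zero_tau_min_i(1) isolated_tau_min_i
              intro!: subsetD [OF ab] Some_mult_zero_nbhd)
    qed
  next
    case (Some r)
    then obtain p q where "s = Some p" "t = Some q"
      by (cases s; cases t) auto
    with st show ?thesis
      by (intro exI [of _ "{s}"] exI [of _ "{t}"]) (auto simp: isolated_tau_min_i)
  qed
  have "openin (prod_topology tau_min_i tau_min_i) {(s, t). ext_bicyclic0_mult s t \<in> U}"
    if "openin tau_min_i U" for U
    unfolding openin_prod_topology_alt using * [OF that] by blast
  then show ?thesis
    by (simp add: continuous_map topspace_tau_min_i case_prod_unfold)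
qed

lemma continuous_map_tau_min_i_swap:
  "continuous_map tau_min_i tau_min_i (map_option prod.swap)"
proof -
  have "openin tau_min_i {s. map_option prod.swap s \<in> U}" if U: "openin tau_min_i U" for U
    unfolding openin_tau_min_i
  proof
    assume "None \<in> {s. map_option prod.swap s \<in> U}"
    with U obtain a b where "zero_nbhd a b \<subseteq> U"
      by (auto simp: openin_tau_min_i)
    then have "zero_nbhd b a \<subseteq> {s. map_option prod.swap s \<in> U}"
      by (auto elim!: zero_nbhd_cases)
    then show "\<exists>a b. zero_nbhd a b \<subseteq> {s. map_option prod.swap s \<in> U}"
      by blast
  qed
  then show ?thesis
    by (simp add: continuous_map topspace_tau_min_i)
qed

lemma topological_inverse_semigroup_tau_min_i:
  "topological_inverse_semigroup ext_bicyclic0_mult tau_min_i"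
  by unfold_locales
     (simp_all add: topspace_tau_min_i continuous_map_tau_min_i_mult
        ext_bicyclic0_inversion continuous_map_tau_min_i_swap)

lemma Hausdorff_space_tau_min_i: "Hausdorff_space tau_min_i"
proof -
  \<comment> \<open>The bound \<open>fst p + 1\<close> on the first coordinate already excludes
    \<open>p\<close>; the second bound \<open>0\<close> is arbitrary.\<close>
  have zero: "\<exists>V. openin tau_min_i V \<and> None \<in> V \<and> Some p \<notin> V" for p
    by (cases p, rule exI [of _ "zero_nbhd (fst p + 1) 0"]) (auto simp: base_at_zero_tau_min_i(1))
  have "\<exists>U V. openin tau_min_i U \<and> openin tau_min_i V \<and> s \<in> U \<and> t \<in> V \<and> disjnt U V"
    if "s \<noteq> t" for s t
  proof (cases s)
    case None
    with that obtain q where "t = Some q"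
      by (cases t) auto
    with zero [of q] None isolated_tau_min_i [of q] show ?thesis
      by (metis disjnt_insert2 disjnt_empty2 singletonI)
  next
    case (Some p)
    have "\<exists>V. openin tau_min_i V \<and> t \<in> V \<and> Some p \<notin> V"
      using that Some zero [of p] isolated_tau_min_i by (cases t) auto
    with Some isolated_tau_min_i [of p] show ?thesis
      by (metis disjnt_insert1 disjnt_empty1 singletonI)
  qed
  then show ?thesis
    by (simp add: Hausdorff_space_def)
qed

section \<open>Arbitrary Hausdorff inverse semigroup topologies\<close>

context
  fixes T :: "ext_bicyclic0 topology"
  assumes T: "topological_inverse_semigroup ext_bicyclic0_mult T" and Hausdorff: "Hausdorff_space T"
begin

interpretation T: topological_inverse_semigroup ext_bicyclic0_mult T
  by (fact T)

lemma continuous_map_ext_bicyclic0_mult: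
  assumes "continuous_map T T f" "continuous_map T T g"
  shows "continuous_map T T (\<lambda>s. ext_bicyclic0_mult (f s) (g s))"
proof -
  have "continuous_map T (prod_topology T T) (\<lambda>s. (f s, g s))"
    using assms by (simp add: continuous_map_pairedI)
  from continuous_map_compose [OF this T.continuous_mult] show ?thesis
    by (simp add: o_def)
qed

lemma continuous_map_ext_bicyclic0_swap: "continuous_map T T (map_option prod.swap)"
  using T.continuous_inversion by (simp add: ext_bicyclic0_inversion)

lemma closedin_left_half_plane: "closedin T {Some (x, y) |x y. x \<le> a}"
proof -
  let ?f = "\<lambda>s. ext_bicyclic0_mult (ext_bicyclic0_mult s (map_option prod.swap s)) (Some (a, a))"
  have "continuous_map T T ?f"
    by (intro continuous_map_ext_bicyclic0_mult continuous_map_ext_bicyclic0_swap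
          continuous_map_id [unfolded id_def]) (simp_all add: T.topspace_UNIV)
  then have "closedin T {s \<in> topspace T. ?f s = Some (a, a)}"
    by (intro closedin_continuous_maps_eq [OF Hausdorff]) (simp_all add: T.topspace_UNIV)
  \<comment> \<open>Zero is sent to zero, so it stays outside the equaliser.\<close>
  moreover have "?f s = Some (a, a) \<longleftrightarrow> (\<exists>x y. s = Some (x, y) \<and> x \<le> a)" for s
    by (cases s) (auto split: if_splits)
  ultimately show ?thesis
    by (simp add: T.topspace_UNIV)
qed

lemma openin_left_half_plane: "openin T {Some (x, y) |x y. x \<le> a}"
proof -
  let ?f = "\<lambda>s. ext_bicyclic0_mult (Some (a + 1, a + 1)) s"
  have "continuous_map T T ?f"
    by (intro continuous_map_ext_bicyclic0_mult continuous_map_id [unfolded id_def])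
       (simp_all add: T.topspace_UNIV)
  then have "closedin T {s \<in> topspace T. ?f s = s}"
    by (intro closedin_continuous_maps_eq [OF Hausdorff]) simp_all
  \<comment> \<open>Zero is fixed, and \<open>Some (x, y)\<close> is fixed exactly when
    \<open>a + 1 \<le> x\<close>, which for integers is the negation of
    \<open>x \<le> a\<close>.\<close>
  moreover have "?f s = s \<longleftrightarrow> \<not> (\<exists>x y. s = Some (x, y) \<and> x \<le> a)" for s
    by (cases s) (auto split: if_splits)
  ultimately have "closedin T (- {Some (x, y) |x y. x \<le> a})"
    by (simp add: T.topspace_UNIV Compl_eq)
  then show ?thesis
    by (simp add: closedin_def T.topspace_UNIV Compl_eq_Diff_UNIV double_diff)
qed

lemma lower_half_plane_eq_vimage:
  "{Some (x, y) |x y. y \<le> b} =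
   {s \<in> topspace T. map_option prod.swap s \<in> {Some (x, y) |x y. x \<le> b}}"
  by (auto simp: T.topspace_UNIV)

lemma closedin_lower_half_plane: "closedin T {Some (x, y) |x y. y \<le> b}"
  unfolding lower_half_plane_eq_vimage
  by (rule closedin_continuous_map_preimage
        [OF continuous_map_ext_bicyclic0_swap closedin_left_half_plane])

lemma openin_lower_half_plane: "openin T {Some (x, y) |x y. y \<le> b}"
  unfolding lower_half_plane_eq_vimage
  by (rule openin_continuous_map_preimage
        [OF continuous_map_ext_bicyclic0_swap openin_left_half_plane])

lemma openin_singleton_Some: "openin T {Some p}"
proof -
  obtain a b where p: "p = (a, b)"
    by fastforce
  \<comment> \<open>Differences of consecutive half-planes are the lines \<open>x = a\<close> and
    \<open>y = b\<close>, which meet only in \<open>p\<close>.\<close>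
  have "openin T (({Some (x, y) |x y. x \<le> a} - {Some (x, y) |x y. x \<le> a - 1}) \<inter>
                  ({Some (x, y) |x y. y \<le> b} - {Some (x, y) |x y. y \<le> b - 1}))"
    by (intro openin_Int openin_diff openin_left_half_plane closedin_left_half_plane
          openin_lower_half_plane closedin_lower_half_plane)
  also have "\<dots> = {Some p}"
    by (auto simp: p)
  finally show ?thesis .
qed

lemma openin_zero_nbhd: "openin T (zero_nbhd a b)"
proof -
  have "openin T (topspace T - {Some (x, y) |x y. x \<le> a - 1} - {Some (x, y) |x y. y \<le> b - 1})"
    by (intro openin_diff openin_topspace closedin_left_half_plane closedin_lower_half_plane)
  also have "\<dots> = zero_nbhd a b"
    by (auto simp: T.topspace_UNIV zero_nbhd_def image_iff)
  finally show ?thesis .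
qed

lemma openin_if_openin_tau_min_i:
  assumes U: "openin tau_min_i U"
  shows "openin T U"
proof (subst openin_subopen, intro ballI)
  fix s assume s: "s \<in> U"
  show "\<exists>V. openin T V \<and> s \<in> V \<and> V \<subseteq> U"
  proof (cases s)
    case None
    with U s obtain a b where "zero_nbhd a b \<subseteq> U"
      by (auto simp: openin_tau_min_i)
    with None show ?thesis
      by (intro exI [of _ "zero_nbhd a b"]) (simp add: openin_zero_nbhd)
  next
    case (Some p)
    with s show ?thesis
      by (intro exI [of _ "{Some p}"]) (simp add: openin_singleton_Some)
  qed
qed

end

theorem proposition5:
  "minimal_topological_inverse_semigroup ext_bicyclic0_mult tau_min_i"
  \<comment> \<open>A strictly coarser competitor would still contain every open set of
    \<open>tau_min_i\<close>, a contradiction.\<close>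
  unfolding minimal_topological_inverse_semigroup_def
  using topological_inverse_semigroup_tau_min_i Hausdorff_space_tau_min_i
    openin_if_openin_tau_min_i
  by blast

end
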